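(* Let $S_1$ and $S_2$ be subrings of finite rings $R_1$ and $R_2$ respectively, and let $r\in K(S_1,R_1)$. If $(\alpha,\beta)$ is a $\mathbb{Z}$-isoclinism between $(S_1,R_1)$ and $(S_2,R_2)$, then $$\mathrm{Pr}_r(S_1,R_1)=\mathrm{Pr}_{\beta(r)}(S_2,R_2).$$
   Context: For elements $x,y$ of a ring $R$, $[x,y]=xy-yx$. For a subring $S$ of a finite ring $R$ and $r\in R$, $$\mathrm{Pr}_r(S,R)=\frac{|\{(x,y)\in S\times R : [x,y]=r\}|}{|S||R|}.$$ $K(S,R)=\{[x,y] : x\in S,\ y\in R\}$; $[S,R]$ denotes the additive subgroup of $(R,+)$ generated by $K(S,R)$; $Z(S,R)=\{x\in S : xy=yx \text{ for all } y\in R\}$. Quotients such as $\frac{R}{Z(S,R)}$ and $\frac{S}{Z(S,R)}$ are quotients of additive groups. A pair of mappings $(\alpha,\beta)$ is a $\mathbb{Z}$-isoclinism between $(S_1,R_1)$ and $(S_2,R_2)$ if $\alpha:\frac{R_1}{Z(S_1,R_1)}\to\frac{R_2}{Z(S_2,R_2)}$ and $\beta:[S_1,R_1]\to[S_2,R_2]$ are additive group isomorphisms such that $\alpha\left(\frac{S_1}{Z(S_1,R_1)}\right)=\frac{S_2}{Z(S_2,R_2)}$, and $\beta([x_1,y_1])=[x_2,y_2]$ whenever $x_i\in S_i$, $y_i\in R_i$ for $i=1,2$ satisfy $\alpha(x_1+Z(S_1,R_1))=x_2+Z(S_2,R_2)$ and $\alpha(y_1+Z(S_1,R_1))=y_2+Z(S_2,R_2)$.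 *)

theory Defs
  imports "HOL.Real" "HOL-Algebra.Generated_Groups" "HOL-Algebra.Subrings"
begin

text \<open>
  Rings here are associative but need not have an identity, and a subring need not contain
  the identity of the ring if there is one. The locales \<^locale>\<open>ring\<close> and \<^locale>\<open>subring\<close> of HOL-Algebra
  are unital, hence the following two. The field \<^const>\<open>one\<close> of the record is irrelevant for them.
\<close>

locale nonunital_ring = abelian_group R for R (structure) +
  assumes mult_closed: "\<lbrakk> x \<in> carrier R; y \<in> carrier R \<rbrakk> \<Longrightarrow> x \<otimes> y \<in> carrier R"
    and mult_assoc: "\<lbrakk> x \<in> carrier R; y \<in> carrier R; z \<in> carrier R \<rbrakk>
      \<Longrightarrow> (x \<otimes> y) \<otimes> z = x \<otimes> (y \<otimes> z)"
    and distrib_right: "\<lbrakk> x \<in> carrier R; y \<in> carrier R; z \<in> carrier R \<rbrakk>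
      \<Longrightarrow> (x \<oplus> y) \<otimes> z = x \<otimes> z \<oplus> y \<otimes> z"
    and distrib_left: "\<lbrakk> x \<in> carrier R; y \<in> carrier R; z \<in> carrier R \<rbrakk>
      \<Longrightarrow> z \<otimes> (x \<oplus> y) = z \<otimes> x \<oplus> z \<otimes> y"

locale nonunital_subring = subgroup S "add_monoid R" for S and R (structure) +
  assumes sub_mult_closed: "\<lbrakk> x \<in> S; y \<in> S \<rbrakk> \<Longrightarrow> x \<otimes> y \<in> S"

lemma ring_imp_nonunital_ring:
  assumes "ring R"
  shows "nonunital_ring R"
proof -
  interpret ring R by (fact assms)
  show ?thesis
    by unfold_locales (simp_all add: m_assoc l_distr r_distr)
qed

lemma subring_imp_nonunital_subring:
  assumes "subring S R"
  shows "nonunital_subring S R"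
proof -
  interpret subring S R by (fact assms)
  show ?thesis
    by unfold_locales simp
qed

definition ring_commutator :: "('a, 'm) ring_scheme \<Rightarrow> 'a \<Rightarrow> 'a \<Rightarrow> 'a" where
  "ring_commutator R x y = x \<otimes>\<^bsub>R\<^esub> y \<ominus>\<^bsub>R\<^esub> y \<otimes>\<^bsub>R\<^esub> x"

text \<open>$K(S,R)$\<close>

definition commutator_set :: "'a set \<Rightarrow> ('a, 'm) ring_scheme \<Rightarrow> 'a set" where
  "commutator_set S R = {ring_commutator R x y | x y. x \<in> S \<and> y \<in> carrier R}"

text \<open>$[S,R]$, as a group\<close>

definition commutator_group :: "'a set \<Rightarrow> ('a, 'm) ring_scheme \<Rightarrow> ('a, 'm) monoid_scheme" where
  "commutator_group S R = subgroup_generated (add_monoid R) (commutator_set S R)"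

text \<open>$Z(S,R)$\<close>

definition relative_center :: "'a set \<Rightarrow> ('a, 'm) ring_scheme \<Rightarrow> 'a set" where
  "relative_center S R = {x \<in> S. \<forall>y \<in> carrier R. x \<otimes>\<^bsub>R\<^esub> y = y \<otimes>\<^bsub>R\<^esub> x}"

text \<open>$\mathrm{Pr}_r(S,R)$\<close>

definition commuting_prob :: "'a \<Rightarrow> 'a set \<Rightarrow> ('a, 'm) ring_scheme \<Rightarrow> real" where
  "commuting_prob r S R =
     real (card {(x, y). x \<in> S \<and> y \<in> carrier R \<and> ring_commutator R x y = r})
       / (real (card S) * real (card (carrier R)))"

text \<open>
  The quotient $S/Z(S,R)$ is the carrier of the factor group of $(S,+)$, whose elements
  are also elements of the factor group $R/Z(S,R)$.
\<close>

definition Z_isoclinism ::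
  "'a set \<Rightarrow> ('a, 'm) ring_scheme \<Rightarrow> 'b set \<Rightarrow> ('b, 'n) ring_scheme
     \<Rightarrow> ('a set \<Rightarrow> 'b set) \<Rightarrow> ('a \<Rightarrow> 'b) \<Rightarrow> bool" where
  "Z_isoclinism S\<^sub>1 R\<^sub>1 S\<^sub>2 R\<^sub>2 \<alpha> \<beta> \<longleftrightarrow>
     (let Z\<^sub>1 = relative_center S\<^sub>1 R\<^sub>1; Z\<^sub>2 = relative_center S\<^sub>2 R\<^sub>2 in
       \<alpha> \<in> iso (R\<^sub>1 A_Mod Z\<^sub>1) (R\<^sub>2 A_Mod Z\<^sub>2) \<and>
       \<beta> \<in> iso (commutator_group S\<^sub>1 R\<^sub>1) (commutator_group S\<^sub>2 R\<^sub>2) \<and>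
       \<alpha> ` carrier (R\<^sub>1\<lparr>carrier := S\<^sub>1\<rparr> A_Mod Z\<^sub>1) = carrier (R\<^sub>2\<lparr>carrier := S\<^sub>2\<rparr> A_Mod Z\<^sub>2) \<and>
       (\<forall>x\<^sub>1 \<in> S\<^sub>1. \<forall>y\<^sub>1 \<in> carrier R\<^sub>1. \<forall>x\<^sub>2 \<in> S\<^sub>2. \<forall>y\<^sub>2 \<in> carrier R\<^sub>2.
          \<alpha> (Z\<^sub>1 +>\<^bsub>R\<^sub>1\<^esub> x\<^sub>1) = Z\<^sub>2 +>\<^bsub>R\<^sub>2\<^esub> x\<^sub>2 \<longrightarrow>
          \<alpha> (Z\<^sub>1 +>\<^bsub>R\<^sub>1\<^esub> y\<^sub>1) = Z\<^sub>2 +>\<^bsub>R\<^sub>2\<^esub> y\<^sub>2 \<longrightarrow>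
          \<beta> (ring_commutator R\<^sub>1 x\<^sub>1 y\<^sub>1) = ring_commutator R\<^sub>2 x\<^sub>2 y\<^sub>2))"

end

theory Submission
  imports Defs
begin

text \<open>
  The commutator \<open>[x, y]\<close> with \<open>x \<in> S\<close>, \<open>y \<in> R\<close> is biadditive and vanishes when either argument
  lies in \<open>Z = Z(S, R)\<close>, so it depends only on the cosets \<open>Z + x\<close> and \<open>Z + y\<close>. Hence the solution
  set of \<open>[x, y] = r\<close> is a union of products of two cosets, and its size is \<open>|Z|\<^sup>2\<close> times the number
  of solutions in \<open>S/Z \<times> R/Z\<close>. As \<open>|S| |R| = |Z|\<^sup>2 |S/Z| |R/Z|\<close>, the factor \<open>|Z|\<^sup>2\<close> cancels and
  the probability can be read off from the quotients alone (\<open>commuting_prob_via_cosets\<close>).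

  An isoclinism transports exactly these data: \<open>\<alpha> \<times> \<alpha>\<close> is a bijection from \<open>S\<^sub>1/Z\<^sub>1 \<times> R\<^sub>1/Z\<^sub>1\<close> to
  \<open>S\<^sub>2/Z\<^sub>2 \<times> R\<^sub>2/Z\<^sub>2\<close>, and since \<open>\<beta>\<close> is injective on \<open>[S\<^sub>1, R\<^sub>1]\<close>, it matches the solutions for \<open>r\<close>
  with the solutions for \<open>\<beta> r\<close> (\<open>isoclinism_maps_solution_cosets\<close>).
\<close>

section \<open>Counting by fibres\<close>

lemma card_eq_mult_card_image:
  assumes "finite A" and fibre: "\<And>a. a \<in> A \<Longrightarrow> card {b \<in> A. f b = f a} = k"
  shows "card A = k * card (f ` A)"
proof -
  have "card A = (\<Sum>y\<in>f ` A. \<Sum>x\<in>{x \<in> A. f x = y}. 1)"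
    using sum.image_gen[OF \<open>finite A\<close>, of "\<lambda>_. 1::nat" f] by simp
  also have "\<dots> = (\<Sum>y\<in>f ` A. k)"
    by (rule sum.cong) (auto simp: fibre)
  finally show ?thesis by simp
qed

section \<open>The commutator map and the cosets of the relative centre\<close>

locale subring_pair = nonunital_ring R + nonunital_subring S R
  for S and R (structure)
begin

abbreviation "Z \<equiv> relative_center S R"

lemma S_subset: "S \<subseteq> carrier R"
  using subset by simp

lemma commutator_closed:
  "x \<in> carrier R \<Longrightarrow> y \<in> carrier R \<Longrightarrow> ring_commutator R x y \<in> carrier R"
  by (simp add: ring_commutator_def mult_closed)

lemma commutator_add_left:
  assumes "x \<in> carrier R" "x' \<in> carrier R" "y \<in> carrier R"
  shows "ring_commutator R (x \<oplus> x') y = ring_commutator R x y \<oplus> ring_commutator R x' y"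
  using assms
  by (simp add: ring_commutator_def distrib_left distrib_right mult_closed a_minus_def
      minus_add a_ac)

lemma commutator_add_right:
  assumes "x \<in> carrier R" "y \<in> carrier R" "y' \<in> carrier R"
  shows "ring_commutator R x (y \<oplus> y') = ring_commutator R x y \<oplus> ring_commutator R x y'"
  using assms
  by (simp add: ring_commutator_def distrib_left distrib_right mult_closed a_minus_def
      minus_add a_ac)

lemma commutator_eq_zero_iff:
  assumes "x \<in> carrier R" "y \<in> carrier R"
  shows "ring_commutator R x y = \<zero> \<longleftrightarrow> x \<otimes> y = y \<otimes> x"
  using assms add.right_cancel[of "\<ominus> (y \<otimes> x)" "x \<otimes> y" "y \<otimes> x"]
  by (simp add: ring_commutator_def mult_closed minus_eq r_neg)

lemma commutator_group_hom:
  assumes "y \<in> carrier R"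
  shows "group_hom (add_monoid R) (add_monoid R) (\<lambda>x. ring_commutator R x y)"
  using assms
  by (intro group_hom.intro group_hom_axioms.intro a_group)
     (auto simp: hom_def commutator_closed commutator_add_left)

text \<open>
  Writing \<open>Z(S, R)\<close> as \<open>S\<close> intersected with the kernels of the homomorphisms \<open>x \<mapsto> [x, y]\<close> makes
  it a subgroup without any computation with inverses.
\<close>

lemma center_subgroup: "subgroup Z (add_monoid R)"
proof -
  let ?K = "\<lambda>y. kernel (add_monoid R) (add_monoid R) (\<lambda>x. ring_commutator R x y)"
  have "Z = \<Inter> (insert S (?K ` carrier R))"
    using S_subset by (auto simp: relative_center_def kernel_def commutator_eq_zero_iff subset_iff)
  moreover have "subgroup (\<Inter> (insert S (?K ` carrier R))) (add_monoid R)"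
    using subgroup_axioms group_hom.subgroup_kernel[OF commutator_group_hom]
    by (intro group.subgroups_Inter[OF a_group]) auto
  ultimately show ?thesis by simp
qed

lemma Z_subset_S: "Z \<subseteq> S"
  by (auto simp: relative_center_def)

lemma coset_subset_S: "x \<in> S \<Longrightarrow> Z +> x \<subseteq> S"
  using Z_subset_S m_closed by (auto simp: a_r_coset_def')

lemma coset_subset: "x \<in> carrier R \<Longrightarrow> Z +> x \<subseteq> carrier R"
  using Z_subset_S S_subset by (auto simp: a_r_coset_def')

lemma coset_eq_iff:
  assumes "x \<in> carrier R" "x' \<in> carrier R"
  shows "Z +> x' = Z +> x \<longleftrightarrow> x' \<in> Z +> x"
proof
  show "x' \<in> Z +> x" if "Z +> x' = Z +> x"
    using group.rcos_self[OF a_group, of x' Z] assms center_subgroup that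
    by (simp add: a_r_coset_def)
  show "Z +> x' = Z +> x" if "x' \<in> Z +> x"
    using group.repr_independence[OF a_group, of x' Z x] assms center_subgroup that
    by (simp add: a_r_coset_def)
qed

lemma coset_fibre:
  assumes "x \<in> carrier R"
  shows "{x' \<in> carrier R. Z +> x' = Z +> x} = Z +> x"
  using assms coset_subset[of x] coset_eq_iff[of x] by auto

lemma coset_fibre_S:
  assumes "x \<in> S"
  shows "{x' \<in> S. Z +> x' = Z +> x} = Z +> x"
proof -
  have "{x' \<in> S. Z +> x' = Z +> x} = {x' \<in> carrier R. Z +> x' = Z +> x} \<inter> S"
    using S_subset by blast
  also have "\<dots> = (Z +> x) \<inter> S"
    using coset_fibre assms S_subset by (simp add: subset_iff)
  also have "\<dots> = Z +> x"
    using coset_subset_S[OF assms] by (rule Int_absorb2)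
  finally show ?thesis .
qed

lemma card_coset:
  assumes "x \<in> carrier R"
  shows "card (Z +> x) = card Z"
proof -
  have "Z +> x \<in> rcosets\<^bsub>add_monoid R\<^esub> Z"
    using assms by (auto simp: a_r_coset_def RCOSETS_def)
  then show ?thesis
    using group.card_rcosets_equal[OF a_group, of _ Z] center_subgroup[THEN subgroup.subset]
    by simp
qed

lemma commutator_center:
  assumes "z \<in> Z" "y \<in> carrier R"
  shows "ring_commutator R z y = \<zero>" "ring_commutator R y z = \<zero>"
proof -
  have z: "z \<in> carrier R" and eq: "z \<otimes> y = y \<otimes> z"
    using assms Z_subset_S S_subset unfolding relative_center_def by blast+
  show "ring_commutator R z y = \<zero>"
    using commutator_eq_zero_iff[OF z assms(2)] eq by blast
  show "ring_commutator R y z = \<zero>"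
    using commutator_eq_zero_iff[OF assms(2) z] eq[symmetric] by blast
qed

text \<open>
  Changing the arguments inside their cosets only adds commutators with an argument in \<open>Z\<close>,
  all of which vanish.
\<close>

lemma commutator_cong_coset:
  assumes "x \<in> carrier R" "y \<in> carrier R" "x' \<in> Z +> x" "y' \<in> Z +> y"
  shows "ring_commutator R x' y' = ring_commutator R x y"
proof -
  obtain z w where z: "z \<in> Z" "x' = z \<oplus> x" and w: "w \<in> Z" "y' = w \<oplus> y"
    using assms by (auto simp: a_r_coset_def')
  have c: "z \<in> carrier R" "w \<in> carrier R"
    using z w Z_subset_S S_subset by auto
  show ?thesis
    using z w c assms(1,2)
    by (simp add: commutator_add_left commutator_add_right commutator_closed commutator_center)
qed

section \<open>The commuting probability in terms of cosets\<close>

definition solutions :: "'a \<Rightarrow> ('a \<times> 'a) set" where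
  "solutions r = {(x, y). x \<in> S \<and> y \<in> carrier R \<and> ring_commutator R x y = r}"

text \<open>
  The solutions in \<open>S/Z \<times> R/Z\<close>. One pair of representatives solving \<open>[x, y] = r\<close> is enough, because
  the commutator is constant on \<open>(Z + x) \<times> (Z + y)\<close>.
\<close>

definition solution_cosets :: "'a \<Rightarrow> ('a set \<times> 'a set) set" where
  "solution_cosets r = (\<lambda>(x, y). (Z +> x, Z +> y)) ` solutions r"

lemma solutions_fibre:
  assumes "(x, y) \<in> solutions r"
  shows "{(x', y') \<in> solutions r. Z +> x' = Z +> x \<and> Z +> y' = Z +> y} = (Z +> x) \<times> (Z +> y)"
proof -
  have xy: "x \<in> S" "x \<in> carrier R" "y \<in> carrier R" "ring_commutator R x y = r"
    using assms S_subset by (auto simp: solutions_def)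
  have "ring_commutator R x' y' = r"
    if "x' \<in> S" "Z +> x' = Z +> x" "y' \<in> carrier R" "Z +> y' = Z +> y" for x' y'
  proof -
    have "x' \<in> carrier R"
      using that S_subset by blast
    then have "x' \<in> Z +> x" "y' \<in> Z +> y"
      using that(2,3,4) coset_eq_iff[OF xy(2), of x'] coset_eq_iff[OF xy(3), of y'] by blast+
    then show ?thesis
      using commutator_cong_coset[OF xy(2,3)] xy(4) by simp
  qed
  then have "{(x', y') \<in> solutions r. Z +> x' = Z +> x \<and> Z +> y' = Z +> y}
      = {x' \<in> S. Z +> x' = Z +> x} \<times> {y' \<in> carrier R. Z +> y' = Z +> y}"
    unfolding solutions_def by blast
  then show ?thesis
    by (simp only: coset_fibre_S[OF xy(1)] coset_fibre[OF xy(3)])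
qed

lemma commuting_prob_via_cosets:
  assumes fin: "finite (carrier R)"
  shows "commuting_prob r S R =
    real (card (solution_cosets r)) /
      (real (card ((+>) Z ` S)) * real (card ((+>) Z ` carrier R)))"
proof -
  have finS: "finite S"
    by (rule finite_subset[OF S_subset fin])
  have finZ: "finite Z"
    by (rule finite_subset[OF Z_subset_S finS])
  have "Z \<noteq> {}"
    using subgroup.one_closed[OF center_subgroup] by auto
  then have Z0: "card Z \<noteq> 0"
    using finZ by simp
  have R: "card (carrier R) = card Z * card ((+>) Z ` carrier R)"
    by (rule card_eq_mult_card_image[OF fin]) (simp add: coset_fibre card_coset)
  have S: "card S = card Z * card ((+>) Z ` S)"
    using S_subset
    by (intro card_eq_mult_card_image[OF finS]) (auto simp: coset_fibre_S card_coset)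
  have finP: "finite (solutions r)"
    by (rule finite_subset[of _ "S \<times> carrier R"]) (auto simp: solutions_def fin finS)
  have P: "card (solutions r) = (card Z * card Z) * card (solution_cosets r)"
    unfolding solution_cosets_def
  proof (rule card_eq_mult_card_image[OF finP])
    fix p assume p: "p \<in> solutions r"
    obtain x y where xy: "p = (x, y)" by (cases p)
    have c: "x \<in> carrier R" "y \<in> carrier R"
      using p xy S_subset by (auto simp: solutions_def)
    have "{q \<in> solutions r. (\<lambda>(x, y). (Z +> x, Z +> y)) q = (\<lambda>(x, y). (Z +> x, Z +> y)) p}
        = {(x', y') \<in> solutions r. Z +> x' = Z +> x \<and> Z +> y' = Z +> y}"
      using xy by auto
    also have "\<dots> = (Z +> x) \<times> (Z +> y)"
      using solutions_fibre[OF p[unfolded xy]] .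
    finally show "card {q \<in> solutions r. (\<lambda>(x, y). (Z +> x, Z +> y)) q =
        (\<lambda>(x, y). (Z +> x, Z +> y)) p} = card Z * card Z"
      by (simp add: card_cartesian_product card_coset c)
  qed
  have "commuting_prob r S R = real (card (solutions r)) / (real (card S) * real (card (carrier R)))"
    by (simp add: commuting_prob_def solutions_def)
  also have "\<dots> = (real (card Z) * real (card Z)) * real (card (solution_cosets r)) /
      ((real (card Z) * real (card Z)) *
        (real (card ((+>) Z ` S)) * real (card ((+>) Z ` carrier R))))"
    unfolding P R S by (simp add: mult_ac)
  finally show ?thesis
    using Z0 by simp
qed

lemma carrier_quotient: "carrier (R A_Mod Z) = (+>) Z ` carrier R"
  by (auto simp: A_FactGroup_def FactGroup_def RCOSETS_def a_r_coset_def)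

lemma carrier_quotient_S: "carrier (R\<lparr>carrier := S\<rparr> A_Mod Z) = (+>) Z ` S"
  by (auto simp: A_FactGroup_def FactGroup_def RCOSETS_def a_r_coset_def r_coset_def)

lemma commutator_in_commutator_group:
  assumes "x \<in> S" "y \<in> carrier R"
  shows "ring_commutator R x y \<in> carrier (commutator_group S R)"
proof -
  have "ring_commutator R x y \<in> carrier R \<inter> commutator_set S R"
    using assms S_subset commutator_closed by (auto simp: commutator_set_def)
  then show ?thesis
    by (simp add: commutator_group_def carrier_subgroup_generated generate.incl)
qed

end

section \<open>Transport along an isoclinism\<close>

text \<open>
  Compatibility of \<open>\<alpha>\<close> and \<open>\<beta>\<close> sends solution cosets for \<open>r\<close> to solution cosets for \<open>\<beta> r\<close>. Every
  solution coset for \<open>\<beta> r\<close> arises in this way: lift it along \<open>\<alpha>\<close> to some \<open>(x, y)\<close>; then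
  \<open>\<beta> [x, y] = \<beta> r\<close>, and injectivity of \<open>\<beta>\<close> gives \<open>[x, y] = r\<close>.
\<close>

lemma isoclinism_maps_solution_cosets:
  fixes R\<^sub>1 :: "('a, 'm) ring_scheme" and R\<^sub>2 :: "('b, 'n) ring_scheme"
  assumes pair1: "subring_pair S\<^sub>1 R\<^sub>1" and pair2: "subring_pair S\<^sub>2 R\<^sub>2"
    and r: "r \<in> commutator_set S\<^sub>1 R\<^sub>1"
    and iso: "Z_isoclinism S\<^sub>1 R\<^sub>1 S\<^sub>2 R\<^sub>2 \<alpha> \<beta>"
  shows "map_prod \<alpha> \<alpha> ` subring_pair.solution_cosets S\<^sub>1 R\<^sub>1 r =
    subring_pair.solution_cosets S\<^sub>2 R\<^sub>2 (\<beta> r)"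
proof -
  interpret A: subring_pair S\<^sub>1 R\<^sub>1 by (fact pair1)
  interpret B: subring_pair S\<^sub>2 R\<^sub>2 by (fact pair2)
  have onR: "\<alpha> ` (+>\<^bsub>R\<^sub>1\<^esub>) A.Z ` carrier R\<^sub>1 = (+>\<^bsub>R\<^sub>2\<^esub>) B.Z ` carrier R\<^sub>2"
    and onS: "\<alpha> ` (+>\<^bsub>R\<^sub>1\<^esub>) A.Z ` S\<^sub>1 = (+>\<^bsub>R\<^sub>2\<^esub>) B.Z ` S\<^sub>2"
    and inj: "inj_on \<beta> (carrier (commutator_group S\<^sub>1 R\<^sub>1))"
    using iso
    by (auto simp: Z_isoclinism_def Let_def iso_def bij_betw_def
        A.carrier_quotient A.carrier_quotient_S B.carrier_quotient B.carrier_quotient_S)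
  have compat: "\<beta> (ring_commutator R\<^sub>1 x\<^sub>1 y\<^sub>1) = ring_commutator R\<^sub>2 x\<^sub>2 y\<^sub>2"
    if "x\<^sub>1 \<in> S\<^sub>1" "y\<^sub>1 \<in> carrier R\<^sub>1" "x\<^sub>2 \<in> S\<^sub>2" "y\<^sub>2 \<in> carrier R\<^sub>2"
      "\<alpha> (A.Z +>\<^bsub>R\<^sub>1\<^esub> x\<^sub>1) = B.Z +>\<^bsub>R\<^sub>2\<^esub> x\<^sub>2" "\<alpha> (A.Z +>\<^bsub>R\<^sub>1\<^esub> y\<^sub>1) = B.Z +>\<^bsub>R\<^sub>2\<^esub> y\<^sub>2"
    for x\<^sub>1 y\<^sub>1 x\<^sub>2 y\<^sub>2
    using iso that unfolding Z_isoclinism_def Let_def by blast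
  have rK: "r \<in> carrier (commutator_group S\<^sub>1 R\<^sub>1)"
    using r A.commutator_in_commutator_group by (auto simp: commutator_set_def)
  show ?thesis
  proof (intro equalityI subsetI)
    fix p assume "p \<in> map_prod \<alpha> \<alpha> ` A.solution_cosets r"
    then obtain x y where xy: "x \<in> S\<^sub>1" "y \<in> carrier R\<^sub>1" "ring_commutator R\<^sub>1 x y = r"
      and p: "p = (\<alpha> (A.Z +>\<^bsub>R\<^sub>1\<^esub> x), \<alpha> (A.Z +>\<^bsub>R\<^sub>1\<^esub> y))"
      by (auto simp: A.solution_cosets_def A.solutions_def)
    obtain x' where x': "x' \<in> S\<^sub>2" "\<alpha> (A.Z +>\<^bsub>R\<^sub>1\<^esub> x) = B.Z +>\<^bsub>R\<^sub>2\<^esub> x'"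
      using onS xy(1) by blast
    obtain y' where y': "y' \<in> carrier R\<^sub>2" "\<alpha> (A.Z +>\<^bsub>R\<^sub>1\<^esub> y) = B.Z +>\<^bsub>R\<^sub>2\<^esub> y'"
      using onR xy(2) by blast
    have "ring_commutator R\<^sub>2 x' y' = \<beta> r"
      using compat[of x y x' y'] x' y' xy by simp
    then have "(x', y') \<in> B.solutions (\<beta> r)"
      using x' y' by (simp add: B.solutions_def)
    then show "p \<in> B.solution_cosets (\<beta> r)"
      unfolding B.solution_cosets_def p x'(2) y'(2) by force
  next
    fix p assume "p \<in> B.solution_cosets (\<beta> r)"
    then obtain x' y' where xy': "x' \<in> S\<^sub>2" "y' \<in> carrier R\<^sub>2" "ring_commutator R\<^sub>2 x' y' = \<beta> r"
      and p: "p = (B.Z +>\<^bsub>R\<^sub>2\<^esub> x', B.Z +>\<^bsub>R\<^sub>2\<^esub> y')"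
      by (auto simp: B.solution_cosets_def B.solutions_def)
    have "B.Z +>\<^bsub>R\<^sub>2\<^esub> x' \<in> \<alpha> ` (+>\<^bsub>R\<^sub>1\<^esub>) A.Z ` S\<^sub>1"
      unfolding onS using xy'(1) by blast
    then obtain x where x: "x \<in> S\<^sub>1" "\<alpha> (A.Z +>\<^bsub>R\<^sub>1\<^esub> x) = B.Z +>\<^bsub>R\<^sub>2\<^esub> x'"
      by (metis imageE)
    have "B.Z +>\<^bsub>R\<^sub>2\<^esub> y' \<in> \<alpha> ` (+>\<^bsub>R\<^sub>1\<^esub>) A.Z ` carrier R\<^sub>1"
      unfolding onR using xy'(2) by blast
    then obtain y where y: "y \<in> carrier R\<^sub>1" "\<alpha> (A.Z +>\<^bsub>R\<^sub>1\<^esub> y) = B.Z +>\<^bsub>R\<^sub>2\<^esub> y'"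
      by (metis imageE)
    have "\<beta> (ring_commutator R\<^sub>1 x y) = \<beta> r"
      using compat[of x y x' y'] x y xy' by simp
    then have "ring_commutator R\<^sub>1 x y = r"
      using inj_onD[OF inj] A.commutator_in_commutator_group[OF x(1) y(1)] rK by blast
    then have "(x, y) \<in> A.solutions r"
      using x y by (simp add: A.solutions_def)
    then have "(A.Z +>\<^bsub>R\<^sub>1\<^esub> x, A.Z +>\<^bsub>R\<^sub>1\<^esub> y) \<in> A.solution_cosets r"
      unfolding A.solution_cosets_def by force
    then show "p \<in> map_prod \<alpha> \<alpha> ` A.solution_cosets r"
      unfolding p x(2)[symmetric] y(2)[symmetric] by force
  qed
qed

theorem theorem4p1:
  fixes R\<^sub>1 :: "('a, 'm) ring_scheme" and R\<^sub>2 :: "('b, 'n) ring_scheme"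
    and S\<^sub>1 :: "'a set" and S\<^sub>2 :: "'b set"
    and \<alpha> :: "'a set \<Rightarrow> 'b set" and \<beta> :: "'a \<Rightarrow> 'b" and r :: 'a
  assumes "nonunital_ring R\<^sub>1" and "finite (carrier R\<^sub>1)" and "nonunital_subring S\<^sub>1 R\<^sub>1"
    and "nonunital_ring R\<^sub>2" and "finite (carrier R\<^sub>2)" and "nonunital_subring S\<^sub>2 R\<^sub>2"
    and "r \<in> commutator_set S\<^sub>1 R\<^sub>1"
    and "Z_isoclinism S\<^sub>1 R\<^sub>1 S\<^sub>2 R\<^sub>2 \<alpha> \<beta>"
  shows "commuting_prob r S\<^sub>1 R\<^sub>1 = commuting_prob (\<beta> r) S\<^sub>2 R\<^sub>2"
proof -
  have pair1: "subring_pair S\<^sub>1 R\<^sub>1" and pair2: "subring_pair S\<^sub>2 R\<^sub>2"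
    using assms by (simp_all add: subring_pair_def)
  interpret A: subring_pair S\<^sub>1 R\<^sub>1 by (fact pair1)
  interpret B: subring_pair S\<^sub>2 R\<^sub>2 by (fact pair2)
  have bij: "bij_betw \<alpha> ((+>\<^bsub>R\<^sub>1\<^esub>) A.Z ` carrier R\<^sub>1) ((+>\<^bsub>R\<^sub>2\<^esub>) B.Z ` carrier R\<^sub>2)"
    and onS: "\<alpha> ` (+>\<^bsub>R\<^sub>1\<^esub>) A.Z ` S\<^sub>1 = (+>\<^bsub>R\<^sub>2\<^esub>) B.Z ` S\<^sub>2"
    using assms(8)
    by (simp_all add: Z_isoclinism_def Let_def iso_def
        A.carrier_quotient A.carrier_quotient_S B.carrier_quotient B.carrier_quotient_S)
  note inj = bij_betw_imp_inj_on[OF bij]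
  have cardR: "card ((+>\<^bsub>R\<^sub>2\<^esub>) B.Z ` carrier R\<^sub>2) = card ((+>\<^bsub>R\<^sub>1\<^esub>) A.Z ` carrier R\<^sub>1)"
    using bij_betw_same_card[OF bij] by simp
  have "inj_on \<alpha> ((+>\<^bsub>R\<^sub>1\<^esub>) A.Z ` S\<^sub>1)"
    using inj by (rule inj_on_subset) (use A.S_subset in blast)
  then have cardS: "card ((+>\<^bsub>R\<^sub>2\<^esub>) B.Z ` S\<^sub>2) = card ((+>\<^bsub>R\<^sub>1\<^esub>) A.Z ` S\<^sub>1)"
    using card_image onS by metis
  have "A.solution_cosets r \<subseteq> ((+>\<^bsub>R\<^sub>1\<^esub>) A.Z ` carrier R\<^sub>1) \<times> ((+>\<^bsub>R\<^sub>1\<^esub>) A.Z ` carrier R\<^sub>1)"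
    using A.S_subset by (auto simp: A.solution_cosets_def A.solutions_def)
  then have "inj_on (map_prod \<alpha> \<alpha>) (A.solution_cosets r)"
    using map_prod_inj_on[OF inj inj] inj_on_subset by blast
  then have "card (B.solution_cosets (\<beta> r)) = card (A.solution_cosets r)"
    unfolding isoclinism_maps_solution_cosets[OF pair1 pair2 assms(7,8), symmetric]
    by (rule card_image)
  then show ?thesis
    by (simp add: A.commuting_prob_via_cosets[OF assms(2)]
        B.commuting_prob_via_cosets[OF assms(5)] cardR cardS)
qed

end
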